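(* Let $k\ge4$ be an integer. If $G$ is a $k$-list-critical signed graph such that $\mu(G)\le1$ and $G$ is not a balanced complete graph of order $k$, then $2|E(G)|\ge\left(k-1+\frac{k-3}{k^2-3}\right)|V(G)|$.
   Context: A signed graph is a finite graph (multiple edges allowed, no loops) with a sign map $\sigma$ assigning $\pm1$ to each edge; $\mu(G)$ is the maximum number of edges joining two vertices. A coloring is a map $\phi:V\to\mathbb{Z}$ with $\phi(v)\ne\sigma(e)\phi(w)$ for every edge $e$ with ends $v,w$. For a list-assignment $L$ ($L(v)\subseteq\mathbb{Z}$), an $L$-coloring is a coloring with $\phi(v)\in L(v)$. $G$ is $L$-critical if it is not $L$-colorable but every proper signed subgraph is $L$-colorable. $G$ is $k$-list-critical if there is a list-assignment $L$ with $|L(v)|=k-1$ for all $v$ such that $G$ is $L$-critical. A balanced complete graph of order $k$ is a signed graph whose underlying graph is the simple $K_k$ and in which every cycle has positive sign product (product of edge signs). *)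

theory Defs
  imports Complex_Main
begin

record ('v, 'e) sgraph =
  verts :: "'v set"
  edges :: "'e set"
  ends :: "'e \<Rightarrow> 'v set"
  sign :: "'e \<Rightarrow> int"

text \<open>Finite and loopless; parallel edges are distinct elements of the edge set having
  the same ends, and they may carry different signs.\<close>

locale signed_graph =
  fixes G :: "('v, 'e) sgraph"
  assumes finite_verts: "finite (verts G)"
    and finite_edges: "finite (edges G)"
    and ends_subset: "e \<in> edges G \<Longrightarrow> ends G e \<subseteq> verts G"
    and card_ends: "e \<in> edges G \<Longrightarrow> card (ends G e) = 2"
    and sign_cases: "e \<in> edges G \<Longrightarrow> sign G e = 1 \<or> sign G e = -1"

definition edges_between :: "('v, 'e) sgraph \<Rightarrow> 'v \<Rightarrow> 'v \<Rightarrow> 'e set" where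
  "edges_between G v w = {e \<in> edges G. ends G e = {v, w}}"

text \<open>Inserting 0 gives graphs with fewer than two vertices multiplicity 0.\<close>

definition max_mult :: "('v, 'e) sgraph \<Rightarrow> nat" where
  "max_mult G = Max (insert 0
     {card (edges_between G v w) | v w. v \<in> verts G \<and> w \<in> verts G \<and> v \<noteq> w})"

text \<open>Only the values on the vertices of the graph matter, for colorings as well as for
  list-assignments.\<close>

definition coloring :: "('v, 'e) sgraph \<Rightarrow> ('v \<Rightarrow> int) \<Rightarrow> bool" where
  "coloring G \<phi> \<longleftrightarrow>
     (\<forall>e \<in> edges G. \<forall>v w. ends G e = {v, w} \<longrightarrow> \<phi> v \<noteq> sign G e * \<phi> w)"

definition list_coloring ::
  "('v, 'e) sgraph \<Rightarrow> ('v \<Rightarrow> int set) \<Rightarrow> ('v \<Rightarrow> int) \<Rightarrow> bool" where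
  "list_coloring G L \<phi> \<longleftrightarrow> coloring G \<phi> \<and> (\<forall>v \<in> verts G. \<phi> v \<in> L v)"

definition list_colorable :: "('v, 'e) sgraph \<Rightarrow> ('v \<Rightarrow> int set) \<Rightarrow> bool" where
  "list_colorable G L \<longleftrightarrow> (\<exists>\<phi>. list_coloring G L \<phi>)"

definition signed_subgraph :: "('v, 'e) sgraph \<Rightarrow> ('v, 'e) sgraph \<Rightarrow> bool" where
  "signed_subgraph H G \<longleftrightarrow> signed_graph H \<and> verts H \<subseteq> verts G \<and> edges H \<subseteq> edges G \<and>
     (\<forall>e \<in> edges H. ends H e = ends G e \<and> sign H e = sign G e)"

text \<open>Records that differ only in the values of \<open>ends\<close> or \<open>sign\<close> outside the edge set
  represent the same signed graph, so properness is not inequality of records.\<close>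

definition proper_signed_subgraph :: "('v, 'e) sgraph \<Rightarrow> ('v, 'e) sgraph \<Rightarrow> bool" where
  "proper_signed_subgraph H G \<longleftrightarrow>
     signed_subgraph H G \<and> (verts H \<noteq> verts G \<or> edges H \<noteq> edges G)"

definition list_critical :: "('v, 'e) sgraph \<Rightarrow> ('v \<Rightarrow> int set) \<Rightarrow> bool" where
  "list_critical G L \<longleftrightarrow> \<not> list_colorable G L \<and>
     (\<forall>H. proper_signed_subgraph H G \<longrightarrow> list_colorable H L)"

definition k_list_critical :: "nat \<Rightarrow> ('v, 'e) sgraph \<Rightarrow> bool" where
  "k_list_critical k G \<longleftrightarrow>
     (\<exists>L. (\<forall>v \<in> verts G. finite (L v) \<and> card (L v) = k - 1) \<and> list_critical G L)"

text \<open>A cycle is given by its vertices \<open>vs\<close> and edges \<open>es\<close> in cyclic order; two parallel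
  edges form a cycle of length 2.\<close>

definition cycle :: "('v, 'e) sgraph \<Rightarrow> 'v list \<Rightarrow> 'e list \<Rightarrow> bool" where
  "cycle G vs es \<longleftrightarrow>
     length vs = length es \<and> length vs \<ge> 2 \<and> distinct vs \<and> distinct es \<and>
     set vs \<subseteq> verts G \<and> set es \<subseteq> edges G \<and>
     (\<forall>i < length vs. ends G (es ! i) = {vs ! i, vs ! (Suc i mod length vs)})"

definition balanced :: "('v, 'e) sgraph \<Rightarrow> bool" where
  "balanced G \<longleftrightarrow> (\<forall>vs es. cycle G vs es \<longrightarrow> prod_list (map (sign G) es) = 1)"

definition balanced_complete :: "nat \<Rightarrow> ('v, 'e) sgraph \<Rightarrow> bool" where
  "balanced_complete k G \<longleftrightarrow> signed_graph G \<and> card (verts G) = k \<and>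
     (\<forall>v \<in> verts G. \<forall>w \<in> verts G. v \<noteq> w \<longrightarrow> card (edges_between G v w) = 1) \<and>
     balanced G"

end

(* Gallai's counting argument. Since G is critical, all degrees are at least k - 1, and every
   connected set T of vertices of degree exactly k - 1 carries a non-colorable list assignment with
   at least deg_T(v) colors at v: color the rest of G and delete the colors that are blocked. Call
   such a set bad. A bad set with a cut vertex splits there into two bad sets, and a bad set
   without cut vertices is regular, because along an edge the two lists correspond under the sign.
   Induction over end blocks then gives 2 e(T) <= (k - 2 + 2/(k - 1)) |T|, except when T is
   (k - 1)-regular without cut vertices; complete or cyclic structure of the blocks is not needed.
   In the exceptional case T is all of G, G is complete, and an unbalanced triangle would allow a
   color to be saved at one vertex. Otherwise two lower bounds for the degree sum, one decreasing
   and one increasing in the number of vertices of degree k - 1, combine to the claim. *)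

theory Submission imports Defs begin

locale simple_signed =
  fixes adj :: "'v \<Rightarrow> 'v \<Rightarrow> bool" and s :: "'v \<Rightarrow> 'v \<Rightarrow> int"
  assumes adj_sym: "adj u v \<Longrightarrow> adj v u"
    and adj_irrefl: "\<not> adj v v"
    and s_sym: "s u v = s v u"
    and s_cases: "s u v = 1 \<or> s u v = -1"
begin

definition nb :: "'v set \<Rightarrow> 'v \<Rightarrow> 'v set" where
  "nb S v = {u \<in> S. adj v u}"

abbreviation deg :: "'v set \<Rightarrow> 'v \<Rightarrow> nat" where
  "deg S v \<equiv> card (nb S v)"

definition proper_on :: "'v set \<Rightarrow> ('v \<Rightarrow> int) \<Rightarrow> bool" where
  "proper_on S \<phi> \<longleftrightarrow> (\<forall>u\<in>S. \<forall>v\<in>S. adj u v \<longrightarrow> \<phi> u \<noteq> s u v * \<phi> v)"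

definition col :: "'v set \<Rightarrow> ('v \<Rightarrow> int set) \<Rightarrow> bool" where
  "col S L \<longleftrightarrow> (\<exists>\<phi>. proper_on S \<phi> \<and> (\<forall>v\<in>S. \<phi> v \<in> L v))"

definition no_edges :: "'v set \<Rightarrow> 'v set \<Rightarrow> bool" where
  "no_edges P Q \<longleftrightarrow> (\<forall>u\<in>P. \<forall>w\<in>Q. \<not> adj u w)"

definition conn :: "'v set \<Rightarrow> bool" where
  "conn S \<longleftrightarrow> (\<forall>P \<subseteq> S. P \<noteq> {} \<longrightarrow> P \<noteq> S \<longrightarrow> \<not> no_edges P (S - P))"

definition nocut :: "'v set \<Rightarrow> bool" where
  "nocut S \<longleftrightarrow> (\<forall>x\<in>S. conn (S - {x}))"

definition bad :: "'v set \<Rightarrow> ('v \<Rightarrow> int set) \<Rightarrow> bool" where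
  "bad S L \<longleftrightarrow> finite S \<and> conn S \<and> (\<forall>v\<in>S. finite (L v) \<and> deg S v \<le> card (L v)) \<and> \<not> col S L"

definition residual :: "'v set \<Rightarrow> ('v \<Rightarrow> int) \<Rightarrow> ('v \<Rightarrow> int set) \<Rightarrow> 'v \<Rightarrow> int set" where
  "residual U \<phi> L v = L v - (\<lambda>u. s v u * \<phi> u) ` nb U v"

lemma s_s [simp]: "s u v * (s u v * c) = c"
  using s_cases[of u v] by auto

lemma s_neq_iff: "a \<noteq> s u v * b \<longleftrightarrow> b \<noteq> s v u * a"
  using s_cases[of u v] s_sym[of u v] by auto

lemma finite_nb [simp]: "finite S \<Longrightarrow> finite (nb S v)"
  by (simp add: nb_def)

lemma no_edges_sym: "no_edges P Q \<Longrightarrow> no_edges Q P"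
  using adj_sym by (auto simp: no_edges_def)

lemma deg_mono: "finite S \<Longrightarrow> P \<subseteq> S \<Longrightarrow> deg P v \<le> deg S v"
  by (rule card_mono) (auto simp: nb_def)

lemma deg_disjoint_Un:
  assumes "finite A" "finite B" "A \<inter> B = {}"
  shows "deg (A \<union> B) v = deg A v + deg B v"
proof -
  have "nb (A \<union> B) v = nb A v \<union> nb B v" by (auto simp: nb_def)
  then show ?thesis using assms by (auto simp: nb_def intro!: card_Un_disjoint)
qed

lemma deg_split: "finite S \<Longrightarrow> U \<subseteq> S \<Longrightarrow> deg S v = deg U v + deg (S - U) v"
  using deg_disjoint_Un[of U "S - U" v] by (metis Diff_disjoint Un_Diff_cancel Un_absorb1 finite_Diff finite_subset)

lemma deg_remove1: "finite S \<Longrightarrow> v \<in> S \<Longrightarrow> deg S u = deg (S - {v}) u + (if adj u v then 1 else 0)"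
  using deg_split[of S "{v}" u] by (cases "adj u v") (auto simp: nb_def Collect_conv_if conj_commute cong: conj_cong)

lemma deg_less_card: "finite S \<Longrightarrow> v \<in> S \<Longrightarrow> deg S v < card S"
  using adj_irrefl[of v] by (intro psubset_card_mono psubsetI) (auto simp: nb_def)

lemma col_residual:
  assumes "U \<subseteq> S" and pr: "proper_on U \<phi>" and "\<forall>v\<in>U. \<phi> v \<in> L v"
    and "col (S - U) (residual U \<phi> L)"
  shows "col S L"
proof -
  obtain \<psi> where \<psi>: "proper_on (S - U) \<psi>" "\<And>v. v \<in> S - U \<Longrightarrow> \<psi> v \<in> residual U \<phi> L v"
    using assms(4) by (auto simp: col_def)
  define \<chi> where "\<chi> v = (if v \<in> U then \<phi> v else \<psi> v)" for v
  have cross: "\<psi> v \<noteq> s v u * \<phi> u" if "v \<in> S - U" "u \<in> U" "adj v u" for u v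
    using \<psi>(2)[of v] that by (auto simp: residual_def nb_def)
  have "proper_on S \<chi>"
    unfolding proper_on_def
  proof (intro ballI impI)
    fix u v assume h: "u \<in> S" "v \<in> S" "adj u v"
    show "\<chi> u \<noteq> s u v * \<chi> v"
      using h pr \<psi>(1) cross[of u v] cross[of v u] adj_sym[of u v] s_neq_iff[of "\<phi> u" u v "\<psi> v"]
      by (auto simp: \<chi>_def proper_on_def)
  qed
  moreover have "\<forall>v\<in>S. \<chi> v \<in> L v"
    using assms(3) \<psi>(2) by (auto simp: \<chi>_def residual_def)
  ultimately show ?thesis by (auto simp: col_def)
qed

lemma card_residual:
  assumes "finite U"
  shows "card (L v) \<le> card (residual U \<phi> L v) + deg U v"
proof -
  have "card (L v) - card ((\<lambda>u. s v u * \<phi> u) ` nb U v) \<le> card (residual U \<phi> L v)"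
    unfolding residual_def using assms by (intro diff_card_le_card_Diff) auto
  moreover have "card ((\<lambda>u. s v u * \<phi> u) ` nb U v) \<le> deg U v"
    using assms by (intro card_image_le) auto
  ultimately show ?thesis by linarith
qed

lemma col_extend:
  assumes "finite S" "v \<in> S" "col (S - {v}) L" "deg S v < card (L v)"
  shows "col S L"
proof -
  obtain \<phi> where \<phi>: "proper_on (S - {v}) \<phi>" "\<forall>u\<in>S - {v}. \<phi> u \<in> L u"
    using assms(3) by (auto simp: col_def)
  have "deg (S - {v}) v \<le> deg S v" using assms(1) by (intro deg_mono) auto
  then have "card (residual (S - {v}) \<phi> L v) > 0"
    using card_residual[of "S - {v}" L v \<phi>] assms(1,4) by auto
  then obtain c where "c \<in> residual (S - {v}) \<phi> L v" by fastforce
  then have "col {v} (residual (S - {v}) \<phi> L)"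
    by (auto simp: col_def proper_on_def adj_irrefl intro!: exI[of _ "\<lambda>_. c"])
  moreover have "S - (S - {v}) = {v}" using assms(2) by auto
  ultimately show ?thesis using col_residual[of "S - {v}" S \<phi> L] \<phi> by auto
qed

lemma col_degenerate:
  assumes "finite S" and "\<And>P. P \<subseteq> S \<Longrightarrow> P \<noteq> {} \<Longrightarrow> \<exists>v\<in>P. deg P v < card (L v)"
  shows "col S L"
  using assms
proof (induction "card S" arbitrary: S rule: less_induct)
  case less
  show ?case
  proof (cases "S = {}")
    case True
    then show ?thesis by (auto simp: col_def proper_on_def)
  next
    case False
    then obtain v where v: "v \<in> S" "deg S v < card (L v)" using less.prems by blast
    have "card (S - {v}) < card S" using v less.prems(1) by (metis card_Diff1_less)
    then have "col (S - {v}) L"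
      using less.hyps[of "S - {v}"] less.prems by blast
    then show ?thesis using col_extend[OF less.prems(1) v(1)] v(2) by blast
  qed
qed

lemma col_conn:
  assumes "finite S" "conn S" and le: "\<And>v. v \<in> S \<Longrightarrow> deg S v \<le> card (L v)"
    and x: "x \<in> S" "deg S x < card (L x)"
  shows "col S L"
proof (rule col_degenerate[OF assms(1)])
  fix P assume P: "P \<subseteq> S" "P \<noteq> {}"
  show "\<exists>v\<in>P. deg P v < card (L v)"
  proof (cases "P = S")
    case True then show ?thesis using x by blast
  next
    case False
    then have "\<not> no_edges P (S - P)"
      using P \<open>conn S\<close> by (simp add: conn_def)
    then obtain u w where uw: "u \<in> P" "w \<in> S - P" "adj u w"
      by (auto simp: no_edges_def)
    have "deg P u < deg S u"
      by (rule psubset_card_mono) (use assms(1) uw P in \<open>auto simp: nb_def\<close>)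
    then show ?thesis using uw P le[of u] by (intro bexI[of _ u]) auto
  qed
qed

lemma bad_card_list: "bad S L \<Longrightarrow> v \<in> S \<Longrightarrow> card (L v) = deg S v"
  using col_conn[of S L v] by (force simp: bad_def)

lemma bad_residual:
  assumes "bad S L" "v \<in> S" "conn (S - {v})" "c \<in> L v"
  shows "bad (S - {v}) (residual {v} (\<lambda>_. c) L)"
proof -
  have "\<not> col (S - {v}) (residual {v} (\<lambda>_. c) L)"
    using col_residual[of "{v}" S "\<lambda>_. c" L] assms by (auto simp: bad_def proper_on_def adj_irrefl)
  moreover have "deg (S - {v}) u \<le> card (residual {v} (\<lambda>_. c) L u)" if "u \<in> S - {v}" for u
    using card_residual[of "{v}" L u "\<lambda>_. c"] deg_split[of S "{v}" u] assms that
    by (force simp: bad_def)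
  ultimately show ?thesis using assms by (auto simp: bad_def residual_def)
qed

lemma bad_transport:
  assumes "bad S L" "v \<in> S" "w \<in> S" "adj v w" "conn (S - {v})" "c \<in> L v"
  shows "s v w * c \<in> L w"
proof (rule ccontr)
  assume "s v w * c \<notin> L w"
  then have "residual {v} (\<lambda>_. c) L w = L w"
    by (auto simp: residual_def nb_def s_sym)
  moreover have "w \<in> S - {v}" using assms adj_irrefl by auto
  ultimately have "card (L w) = deg (S - {v}) w"
    using bad_card_list[OF bad_residual[OF assms(1,2,5,6)], of w] by simp
  moreover have "deg S w = deg (S - {v}) w + 1"
    using deg_remove1[of S v w] assms adj_sym by (auto simp: bad_def)
  ultimately show False using bad_card_list[OF assms(1,3)] by simp
qed

lemma conn_constant:
  assumes "conn S" "\<And>u v. u \<in> S \<Longrightarrow> v \<in> S \<Longrightarrow> adj u v \<Longrightarrow> f u = f v" "a \<in> S" "b \<in> S"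
  shows "f a = f b"
proof (rule ccontr)
  assume "f a \<noteq> f b"
  let ?P = "{u \<in> S. f u = f a}"
  have "b \<in> S - ?P" using assms(4) \<open>f a \<noteq> f b\<close> by auto
  then have "?P \<subseteq> S" "?P \<noteq> {}" "?P \<noteq> S" using assms(3) by blast+
  then have "\<not> no_edges ?P (S - ?P)" using assms(1) by (auto simp: conn_def)
  then show False using assms(2) by (auto simp: no_edges_def)
qed

lemma bad_nocut_regular:
  assumes "bad S L" "nocut S" "a \<in> S" "b \<in> S"
  shows "deg S a = deg S b"
proof (rule conn_constant[of S])
  have le: "deg S u \<le> deg S v" if "u \<in> S" "v \<in> S" "adj u v" for u v
  proof -
    have "card (L u) \<le> card (L v)"
    proof (rule card_inj_on_le)
      show "inj_on (\<lambda>c. s u v * c) (L u)" using s_cases[of u v] by (auto simp: inj_on_def)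
      show "(\<lambda>c. s u v * c) ` L u \<subseteq> L v"
        using bad_transport[of S L u v] assms that by (auto simp: nocut_def)
      show "finite (L v)" using assms that by (auto simp: bad_def)
    qed
    then show ?thesis using bad_card_list[OF assms(1)] that by simp
  qed
  show "deg S u = deg S v" if "u \<in> S" "v \<in> S" "adj u v" for u v
    using le[of u v] le[of v u] that adj_sym by force
qed (use assms in \<open>auto simp: bad_def\<close>)

definition sep :: "'v set \<Rightarrow> 'v set \<Rightarrow> 'v \<Rightarrow> bool" where
  "sep S P x \<longleftrightarrow> x \<in> S \<and> P \<subseteq> S - {x} \<and> P \<noteq> {} \<and> P \<noteq> S - {x} \<and> no_edges P (S - {x} - P)"

lemma sep_compl: "sep S P x \<Longrightarrow> sep S (S - {x} - P) x"
  unfolding sep_def using no_edges_sym by (auto simp: double_diff)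

lemma not_nocut_sep: "\<not> nocut S \<Longrightarrow> \<exists>P x. sep S P x"
  unfolding nocut_def conn_def sep_def by meson

lemma conn_sep:
  assumes "conn S" "sep S P x"
  shows "conn (insert x P)"
  unfolding conn_def
proof (intro allI impI)
  fix Q assume Q: "Q \<subseteq> insert x P" "Q \<noteq> {}" "Q \<noteq> insert x P"
  have inner: "\<not> no_edges R (insert x P - R)" if "R \<subseteq> P" "R \<noteq> {}" for R
  proof -
    have "R \<subseteq> S" "R \<noteq> S" using that assms by (auto simp: sep_def)
    then have "\<not> no_edges R (S - R)" using assms that by (auto simp: conn_def)
    then obtain u w where "u \<in> R" "w \<in> S - R" "adj u w" by (auto simp: no_edges_def)
    moreover from this have "w \<in> insert x P"
      using that(1) assms(2) by (auto simp: sep_def no_edges_def)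
    ultimately show ?thesis by (auto simp: no_edges_def)
  qed
  show "\<not> no_edges Q (insert x P - Q)"
  proof (cases "x \<in> Q")
    case False then show ?thesis using inner[of Q] Q by auto
  next
    case True
    have "insert x P - (insert x P - Q) = Q" using Q by auto
    moreover have "insert x P - Q \<subseteq> P" "insert x P - Q \<noteq> {}" using True Q by auto
    ultimately show ?thesis using inner[of "insert x P - Q"] no_edges_sym by metis
  qed
qed

lemma deg_sep_inner:
  assumes "sep S P x" "v \<in> P" shows "deg (insert x P) v = deg S v"
proof -
  have "nb (insert x P) v = nb S v"
    using assms by (auto simp: nb_def sep_def no_edges_def)
  then show ?thesis by simp
qed

lemma deg_sep_cut:
  assumes "finite S" "sep S P x"
  shows "deg S x = deg (insert x P) x + deg (S - P) x"
proof -
  have "deg S x = deg P x + deg (S - P) x" using assms by (intro deg_split) (auto simp: sep_def)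
  moreover have "nb (insert x P) x = nb P x" by (auto simp: nb_def adj_irrefl)
  ultimately show ?thesis by simp
qed

lemma sep_compl_eq: "sep S P x \<Longrightarrow> insert x (S - {x} - P) = S - P"
  by (auto simp: sep_def)

text \<open>At the cut vertex \<open>x\<close> only the colors that no coloring of \<open>A\<close> uses are kept. If the whole
  set is not colorable, every color of \<open>x\<close> is excluded by one of the two sides.\<close>

definition blocked :: "'v set \<Rightarrow> 'v \<Rightarrow> ('v \<Rightarrow> int set) \<Rightarrow> 'v \<Rightarrow> int set" where
  "blocked A x L = L(x := {c \<in> L x. \<not> col A (L(x := {c}))})"

lemma not_col_blocked:
  assumes "x \<in> A"
  shows "\<not> col A (blocked A x L)"
proof
  assume "col A (blocked A x L)"
  then obtain \<phi> where \<phi>: "proper_on A \<phi>" "\<forall>v\<in>A. \<phi> v \<in> blocked A x L v" by (auto simp: col_def)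
  then have "\<forall>v\<in>A. \<phi> v \<in> (L(x := {\<phi> x})) v" by (auto simp: blocked_def)
  then have "col A (L(x := {\<phi> x}))" using \<phi>(1) unfolding col_def by blast
  then show False using \<phi> assms by (auto simp: blocked_def)
qed

lemma bad_sep:
  assumes "bad S L" "sep S P x"
  shows "bad (insert x P) (blocked (insert x P) x L) \<and> bad (S - P) (blocked (S - P) x L)"
proof -
  define A where "A = insert x P"
  define B where "B = S - P"
  have fin: "finite S" "finite A" "finite B" and x: "x \<in> A" "x \<in> B" "x \<in> S" "x \<notin> P"
    using assms by (auto simp: bad_def sep_def A_def B_def intro: finite_subset)
  have sep': "sep S (S - {x} - P) x" using assms(2) by (rule sep_compl)
  have B_eq: "B = insert x (S - {x} - P)" using sep_compl_eq[OF assms(2)] by (simp add: B_def)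
  have conn: "conn A" "conn B"
    using conn_sep[OF _ assms(2)] conn_sep[OF _ sep'] assms(1) by (auto simp: bad_def A_def B_eq)
  have fin_blocked: "finite (blocked C x L v)" if "v \<in> S" for v C
    using assms(1) that by (auto simp: bad_def blocked_def)
  have inner_A: "deg A v \<le> card (blocked C x L v)" if "v \<in> A - {x}" for v C
    using deg_sep_inner[OF assms(2), of v] that assms by (auto simp: A_def blocked_def bad_def sep_def)
  have inner_B: "deg B v \<le> card (blocked C x L v)" if "v \<in> B - {x}" for v C
    using deg_sep_inner[OF sep', of v] that assms by (auto simp: B_eq blocked_def bad_def)
  have le_A: "card (blocked A x L x) \<le> deg A x"
  proof (rule ccontr)
    assume "\<not> ?thesis"
    then have gt: "deg A x < card (blocked A x L x)" by simp
    then have "deg A v \<le> card (blocked A x L v)" if "v \<in> A" for v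
      using inner_A[of v] that by (cases "v = x") auto
    then have "col A (blocked A x L)"
      using col_conn[of A "blocked A x L" x] fin conn x gt by blast
    then show False using not_col_blocked x by blast
  qed
  have le_B: "card (blocked B x L x) \<le> deg B x"
  proof (rule ccontr)
    assume "\<not> ?thesis"
    then have gt: "deg B x < card (blocked B x L x)" by simp
    then have "deg B v \<le> card (blocked B x L v)" if "v \<in> B" for v
      using inner_B[of v] that by (cases "v = x") auto
    then have "col B (blocked B x L)"
      using col_conn[of B "blocked B x L" x] fin conn x gt by blast
    then show False using not_col_blocked x by blast
  qed
  have "L x \<subseteq> blocked A x L x \<union> blocked B x L x"
  proof (rule ccontr)
    assume "\<not> ?thesis"
    then obtain c where c: "c \<in> L x" "col A (L(x := {c}))" "col B (L(x := {c}))"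
      by (auto simp: blocked_def)
    then obtain \<phi> \<psi> where \<phi>: "proper_on A \<phi>" "\<forall>v\<in>A. \<phi> v \<in> (L(x := {c})) v"
      and \<psi>: "proper_on B \<psi>" "\<forall>v\<in>B. \<psi> v \<in> (L(x := {c})) v"
      by (auto simp: col_def)
    define \<chi> where "\<chi> v = (if v \<in> A then \<phi> v else \<psi> v)" for v
    have \<chi>A: "\<chi> v = \<phi> v" if "v \<in> A" for v using that by (simp add: \<chi>_def)
    have \<chi>B: "\<chi> v = \<psi> v" if "v \<in> B" for v
    proof (cases "v = x")
      case True
      have "\<phi> x = c" "\<psi> x = c" using \<phi>(2) \<psi>(2) x by force+
      then show ?thesis using True x by (simp add: \<chi>_def)
    qed (use that in \<open>auto simp: \<chi>_def A_def B_def\<close>)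
    have edge: "u \<in> A \<and> v \<in> A \<or> u \<in> B \<and> v \<in> B" if "u \<in> S" "v \<in> S" "adj u v" for u v
      using that assms(2) adj_sym[OF that(3)]
      by (auto simp: A_def B_def sep_def no_edges_def)
    have "proper_on S \<chi>"
      unfolding proper_on_def
    proof (intro ballI impI)
      fix u v assume h: "u \<in> S" "v \<in> S" "adj u v"
      from edge[OF h] show "\<chi> u \<noteq> s u v * \<chi> v"
        using \<phi>(1) \<psi>(1) h \<chi>A \<chi>B by (auto simp: proper_on_def)
    qed
    moreover have "\<chi> v \<in> L v" if "v \<in> S" for v
    proof -
      have "v \<in> A \<or> v \<in> B" using that by (auto simp: A_def B_def)
      then show ?thesis using \<phi>(2) \<psi>(2) \<chi>A \<chi>B c(1) by (auto split: if_splits)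
    qed
    ultimately have "col S L" by (auto simp: col_def)
    then show False using assms(1) by (simp add: bad_def)
  qed
  then have "card (L x) \<le> card (blocked A x L x \<union> blocked B x L x)"
    using fin_blocked x by (intro card_mono) auto
  also have "\<dots> \<le> card (blocked A x L x) + card (blocked B x L x)" by (rule card_Un_le)
  finally have "deg A x + deg B x \<le> card (blocked A x L x) + card (blocked B x L x)"
    using deg_sep_cut[OF fin(1) assms(2)] bad_card_list[OF assms(1) x(3)] by (simp add: A_def B_def)
  then have "deg A x \<le> card (blocked A x L x)" "deg B x \<le> card (blocked B x L x)"
    using le_A le_B by linarith+
  then have "\<forall>v\<in>A. deg A v \<le> card (blocked A x L v)" "\<forall>v\<in>B. deg B v \<le> card (blocked B x L v)"
    using inner_A inner_B by auto
  moreover have "A \<subseteq> S" "B \<subseteq> S" using assms(2) by (auto simp: A_def B_def sep_def)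
  ultimately have "bad A (blocked A x L) \<and> bad B (blocked B x L)"
    using fin conn fin_blocked not_col_blocked x by (auto simp: bad_def)
  then show ?thesis by (simp add: A_def B_def)
qed

lemma sep_leaf:
  assumes "finite S" "sep S P x"
  shows "\<exists>Q y. Q \<subseteq> P \<and> sep S Q y \<and> nocut (insert y Q)"
  using assms(2)
proof (induction "card P" arbitrary: P x rule: less_induct)
  case less
  have finP: "finite P" and x: "x \<in> S" "x \<notin> P" "P \<subseteq> S"
    using less.prems assms by (auto simp: sep_def intro: finite_subset)
  have step: "\<exists>Q y. Q \<subseteq> P \<and> sep S Q y \<and> nocut (insert y Q)" if RP: "R \<subset> P" "sep S R z" for R z
  proof -
    have "card R < card P" using finP RP(1) by (rule psubset_card_mono)
    then obtain Q y where "Q \<subseteq> R" "sep S Q y" "nocut (insert y Q)"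
      using less.hyps[of R z] RP(2) by blast
    then show ?thesis using RP(1) by (meson psubsetE subset_trans)
  qed
  show ?case
  proof (cases "nocut (insert x P)")
    case True
    then show ?thesis using less.prems by blast
  next
    case False
    then obtain Q y where Q: "sep (insert x P) Q y" using not_nocut_sep by blast
    have out: "adj p w \<Longrightarrow> w \<in> S \<Longrightarrow> p \<in> P \<Longrightarrow> w \<in> insert x P" for p w
      using less.prems by (auto simp: sep_def no_edges_def)
    have key: "\<exists>Q y. Q \<subseteq> P \<and> sep S Q y \<and> nocut (insert y Q)" if R: "sep (insert x P) R y" "x \<notin> R" for R
    proof (rule step)
      have yR: "y \<in> insert x P" "y \<notin> R" "R \<subseteq> P" "R \<noteq> {}" "R \<noteq> insert x P - {y}"
        using R by (auto simp: sep_def)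
      show "R \<subset> P" using yR x by (cases "y = x") auto
      have "R \<noteq> S - {y}"
      proof (cases "y = x")
        case True then show ?thesis using yR x by auto
      next
        case False then show ?thesis using R(2) x by auto
      qed
      moreover have "no_edges R (S - {y} - R)"
        unfolding no_edges_def
      proof (intro ballI notI)
        fix u w assume uw: "u \<in> R" "w \<in> S - {y} - R" "adj u w"
        then have "w \<in> insert x P - {y} - R" using out yR(3) by blast
        then show False using uw R(1) by (auto simp: sep_def no_edges_def)
      qed
      ultimately show "sep S R y" using yR x by (auto simp: sep_def)
    qed
    show ?thesis
    proof (cases "x \<in> Q")
      case False then show ?thesis using key[OF Q] by blast
    next
      case True then show ?thesis using key[OF sep_compl[OF Q]] by blast
    qed
  qed
qed

lemma bad_nonempty: "bad S L \<Longrightarrow> S \<noteq> {}"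
  by (auto simp: bad_def col_def proper_on_def)

lemma bad_nocut_deg:
  assumes "bad S L" "nocut S"
  obtains r where "\<And>v. v \<in> S \<Longrightarrow> deg S v = r" "r + 1 \<le> card S"
proof -
  obtain a where a: "a \<in> S" using bad_nonempty[OF assms(1)] by blast
  show ?thesis
  proof
    show "deg S v = deg S a" if "v \<in> S" for v using bad_nocut_regular[OF assms that a] .
    show "deg S a + 1 \<le> card S" using deg_less_card[of S a] a assms(1) by (simp add: bad_def)
  qed
qed

lemma conn_deg_pos:
  assumes "finite S" "conn S" "x \<in> S" "y \<in> S" "x \<noteq> y"
  shows "deg S x > 0"
proof -
  have "{x} \<subseteq> S" "{x} \<noteq> S" using assms by auto
  then have "\<not> no_edges {x} (S - {x})" using assms(2) by (simp add: conn_def)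
  then have "nb S x \<noteq> {}" by (auto simp: no_edges_def nb_def)
  then show ?thesis using assms by (simp add: card_gt_0_iff)
qed

lemma conn_remove_pendant:
  assumes "finite S" "conn S" "x \<in> S" "deg S x = 1"
  shows "conn (S - {x})"
  unfolding conn_def
proof (intro allI impI notI)
  fix Q assume Q: "Q \<subseteq> S - {x}" "Q \<noteq> {}" "Q \<noteq> S - {x}" "no_edges Q (S - {x} - Q)"
  obtain y where y: "nb S x = {y}" using assms(4) by (auto simp: card_1_singleton_iff)
  define R where "R = (if y \<in> Q then insert x Q else Q)"
  have "R \<subseteq> S" "R \<noteq> {}" "R \<noteq> S" using Q assms(3) by (auto simp: R_def)
  then have "\<not> no_edges R (S - R)" using assms(2) by (simp add: conn_def)
  then obtain u w where uw: "u \<in> R" "w \<in> S - R" "adj u w" by (auto simp: no_edges_def)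
  have nbx: "v = y" if "adj x v \<or> adj v x" "v \<in> S" for v
  proof -
    have "v \<in> nb S x" using that adj_sym unfolding nb_def by blast
    then show ?thesis using y by simp
  qed
  show False
  proof (cases "y \<in> Q")
    case True
    then have "w \<in> S - {x} - Q" using uw by (auto simp: R_def)
    moreover from this have "u \<noteq> x" using True uw(3) nbx[of w] by blast
    ultimately show ?thesis using uw(1,3) Q(4) True by (auto simp: R_def no_edges_def)
  next
    case False
    then have "u \<in> Q" "w \<in> S - Q" using uw by (auto simp: R_def)
    moreover have "w \<noteq> x" using False uw nbx[of u] Q(1) \<open>u \<in> Q\<close> by blast
    ultimately show ?thesis using uw(3) Q(4) by (auto simp: no_edges_def)
  qed
qed

lemma sum_deg_sep:
  assumes "finite S" "sep S P x"
  shows "(\<Sum>v\<in>S. deg S v) =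
    (\<Sum>v\<in>insert x P. deg (insert x P) v) + (\<Sum>v\<in>S - P. deg (S - P) v)"
proof -
  have fin: "finite P" "x \<notin> P" "P \<subseteq> S" "x \<in> S - P"
    using assms by (auto simp: sep_def intro: finite_subset)
  have 1: "deg (insert x P) v = deg S v" if "v \<in> P" for v
    using deg_sep_inner[OF assms(2) that] .
  have 2: "deg (S - P) v = deg S v" if "v \<in> S - P - {x}" for v
    using deg_sep_inner[OF sep_compl[OF assms(2)], of v] that sep_compl_eq[OF assms(2)] by auto
  have "(\<Sum>v\<in>S. deg S v) = (\<Sum>v\<in>P. deg S v) + (\<Sum>v\<in>S - P. deg S v)"
    using assms(1) fin by (metis add.commute sum.subset_diff)
  also have "(\<Sum>v\<in>S - P. deg S v) = deg S x + (\<Sum>v\<in>S - P - {x}. deg S v)"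
    using assms(1) fin by (intro sum.remove) auto
  also have "(\<Sum>v\<in>S - P - {x}. deg S v) = (\<Sum>v\<in>S - P - {x}. deg (S - P) v)"
    using 2 by (intro sum.cong) auto
  also have "(\<Sum>v\<in>P. deg S v) = (\<Sum>v\<in>P. deg (insert x P) v)"
    using 1 by (intro sum.cong) auto
  also have "deg S x = deg (insert x P) x + deg (S - P) x" by (rule deg_sep_cut[OF assms])
  finally show ?thesis
    using assms(1) fin by (simp add: sum.remove[of "S - P" x])
qed

lemma sum_deg_remove:
  assumes "finite S" "x \<in> S"
  shows "(\<Sum>v\<in>S. deg S v) = (\<Sum>v\<in>S - {x}. deg (S - {x}) v) + 2 * deg S x"
proof -
  have "(\<Sum>v\<in>S - {x}. deg S v) = (\<Sum>v\<in>S - {x}. deg (S - {x}) v) + (\<Sum>v\<in>S - {x}. if adj v x then 1 else 0)"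
    using assms by (simp add: deg_remove1[OF assms] sum.distrib)
  also have "(\<Sum>v\<in>S - {x}. if adj v x then 1 else 0) = card {v \<in> S - {x}. adj v x}"
    using assms by (simp add: sum.If_cases Int_def)
  also have "{v \<in> S - {x}. adj v x} = nb S x"
    using adj_sym adj_irrefl by (auto simp: nb_def)
  finally show ?thesis using assms by (simp add: sum.remove[of S x])
qed

text \<open>This is \<open>2 * e(S) \<le> (k - 2 + 2 / (k - 1)) * card S - 2\<close> multiplied by \<open>M = k - 1\<close>.\<close>

definition sparse :: "nat \<Rightarrow> 'v set \<Rightarrow> bool" where
  "sparse M S \<longleftrightarrow>
     int M * (int (\<Sum>v\<in>S. deg S v) + 2) \<le> (int M * int M - int M + 2) * int (card S)"

lemma gallai_arith_regular:
  fixes M r n :: int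
  assumes "3 \<le> M" "0 \<le> r" "r < M" "r + 1 \<le> n"
  shows "M * (r * n + 2) \<le> (M * M - M + 2) * n"
proof -
  define t where "t = M - 1 - r"
  have t: "0 \<le> t" "t \<le> M - 1" "r = M - 1 - t" using assms by (auto simp: t_def)
  have "M * t \<le> M * (M - 1)" using t assms by (intro mult_left_mono) auto
  then have "0 \<le> M * M - 2 - M * t" using assms by (simp add: algebra_simps)
  then have "0 \<le> t * (M * M - 2 - M * t)" using t by simp
  moreover have "0 \<le> (2 + M * t) * (n - (r + 1))" using t assms by simp
  moreover have "(M * M - M + 2) * n - M * (r * n + 2)
      = (2 + M * t) * (n - (r + 1)) + t * (M * M - 2 - M * t)"
    unfolding t(3) by (simp add: algebra_simps)
  ultimately show ?thesis by linarith
qed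

lemma gallai_arith_leaf:
  fixes M r n b B :: int
  assumes "3 \<le> M" "1 \<le> r" "r \<le> M - 2" "r + 1 \<le> n" and IH: "M * (B + 2) \<le> (M * M - M + 2) * b"
  shows "M * (r * n + B + 2) \<le> (M * M - M + 2) * (n + b - 1)"
proof -
  define t where "t = M - 2 - r"
  have t: "0 \<le> t" "r = M - 2 - t" using assms by (auto simp: t_def)
  have "0 \<le> (M * M - M + 2 - M * r) * (n - (r + 1))"
    using t assms by (intro mult_nonneg_nonneg) (auto simp: t(2) algebra_simps)
  moreover have "0 \<le> r * (2 + M * t)" using assms t by simp
  moreover have "(M * M - M + 2) * (n - 1) - M * r * n
      = (M * M - M + 2 - M * r) * (n - (r + 1)) + r * (2 + M * t)"
    unfolding t(2) by (simp add: algebra_simps)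
  ultimately show ?thesis using IH by (simp add: algebra_simps)
qed

lemma gallai_arith_pendant:
  fixes M n b B :: int
  assumes "M \<le> n" and IH: "M * (B + 2) \<le> (M * M - M + 2) * b"
  shows "M * ((M - 1) * n + B + 2 + 2) \<le> (M * M - M + 2) * (n + b)"
  using assms by (simp add: algebra_simps)

lemma bad_sparse:
  assumes "3 \<le> M" "bad S L" "\<And>v. v \<in> S \<Longrightarrow> deg S v \<le> M"
  shows "sparse M S \<or> nocut S \<and> (\<forall>v\<in>S. deg S v = M)"
  using assms(2,3)
proof (induction "card S" arbitrary: S L rule: less_induct)
  case less
  have finS: "finite S" using less.prems by (simp add: bad_def)
  have regular_sum: "(\<Sum>v\<in>A. deg A v) = r * card A" if "\<And>v. v \<in> A \<Longrightarrow> deg A v = r" for A r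
    using that by simp
  show ?case
  proof (cases "nocut S")
    case True
    obtain r where r: "\<And>v. v \<in> S \<Longrightarrow> deg S v = r" "r + 1 \<le> card S"
      using bad_nocut_deg[OF less.prems(1) True] by blast
    obtain a where "a \<in> S" using bad_nonempty[OF less.prems(1)] by blast
    then have "r \<le> M" using r(1) less.prems(2) by metis
    moreover have "sparse M S" if "r < M"
      using gallai_arith_regular[of "int M" "int r" "int (card S)"] assms(1) r that
      by (simp add: sparse_def regular_sum[OF r(1)] mult.commute)
    ultimately show ?thesis using True r(1) by (cases "r = M") auto
  next
    case False
    then obtain P\<^sub>0 x\<^sub>0 where "sep S P\<^sub>0 x\<^sub>0" using not_nocut_sep by blast
    then obtain P x where P: "sep S P x" "nocut (insert x P)" using sep_leaf[OF finS] by blast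
    define A where "A = insert x P"
    define B where "B = S - P"
    have x: "x \<in> S" "x \<notin> P" "x \<in> A" "x \<in> B" and PS: "P \<subseteq> S" "P \<noteq> {}" "P \<noteq> S - {x}"
      using P by (auto simp: A_def B_def sep_def)
    have finAB: "finite A" "finite B" "finite P"
      using finS PS by (auto simp: A_def B_def intro: finite_subset)
    obtain LA LB where bad: "bad A LA" "bad B LB"
      using bad_sep[OF less.prems(1) P(1)] by (auto simp: A_def B_def)
    obtain r where r: "\<And>v. v \<in> A \<Longrightarrow> deg A v = r" "r + 1 \<le> card A"
      using bad_nocut_deg[OF bad(1)] P(2) by (auto simp: A_def)
    have degx: "deg S x = r + deg B x"
      using deg_sep_cut[OF finS P(1)] r(1)[OF x(3)] by (simp add: A_def B_def)
    obtain p where "p \<in> P" using PS by blast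
    then have "deg A x > 0"
      using bad(1) x by (intro conn_deg_pos[of _ _ p]) (auto simp: bad_def A_def)
    then have r1: "1 \<le> r" using r(1)[OF x(3)] by simp
    obtain q where "q \<in> B" "q \<noteq> x" using PS x by (auto simp: B_def)
    then have dB: "deg B x > 0"
      using bad(2) x by (intro conn_deg_pos[of _ _ q]) (auto simp: bad_def)
    have rM: "r + deg B x \<le> M" using less.prems(2)[OF x(1)] degx by simp
    have cardS: "card A + card B = card S + 1"
      using finS finAB PS x card_Diff_subset[of P S] card_mono[OF finS PS(1)] by (simp add: A_def B_def)
    have sumS: "(\<Sum>v\<in>S. deg S v) = r * card A + (\<Sum>v\<in>B. deg B v)"
      using sum_deg_sep[OF finS P(1)] regular_sum[OF r(1)] by (simp add: A_def B_def)
    have BS: "B \<subseteq> S" by (auto simp: B_def)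
    have le_M: "deg C v \<le> M" if "C \<subseteq> S" "v \<in> C" for C v
      using order_trans[OF deg_mono[OF finS that(1)] less.prems(2)] that by blast
    have "sparse M S"
    proof (cases "r \<le> M - 2")
      case True
      have "card B < card S" using cardS r(2) r1 by linarith
      then have "sparse M B \<or> nocut B \<and> (\<forall>v\<in>B. deg B v = M)"
        using bad(2) le_M[OF BS] by (rule less.hyps)
      moreover have "deg B x \<noteq> M" using rM r1 by linarith
      ultimately have IH: "sparse M B" using x(4) by blast
      have "int (card S) = int (card A) + int (card B) - 1" using cardS by linarith
      moreover have "int M * (int r * int (card A) + int (\<Sum>v\<in>B. deg B v) + 2)
          \<le> (int M * int M - int M + 2) * (int (card A) + int (card B) - 1)"
      proof (rule gallai_arith_leaf)
        show "int M * (int (\<Sum>v\<in>B. deg B v) + 2) \<le> (int M * int M - int M + 2) * int (card B)"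
          using IH by (simp only: sparse_def)
      qed (use assms(1) r1 True r(2) in linarith)+
      ultimately show ?thesis by (simp only: sparse_def sumS of_nat_add of_nat_mult)
    next
      case False
      then have rM': "M = r + 1" "deg B x = 1" using rM dB by auto
      have conn: "conn (B - {x})"
        using conn_remove_pendant[of B x] bad(2) x rM' by (auto simp: bad_def)
      have "card (LB x) = 1" using bad_card_list[OF bad(2) x(4)] rM' by simp
      then obtain c where "c \<in> LB x" by (auto simp: card_1_singleton_iff)
      then have bad': "bad (B - {x}) (residual {x} (\<lambda>_. c) LB)"
        using bad_residual[OF bad(2) x(4) conn] by blast
      have cardB: "card B = card (B - {x}) + 1" using card_Suc_Diff1[OF finAB(2) x(4)] by simp
      then have "card (B - {x}) < card S" using cardS r(2) r1 by linarith
      moreover have "B - {x} \<subseteq> S" using BS by blast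
      ultimately have or: "sparse M (B - {x}) \<or> nocut (B - {x}) \<and> (\<forall>v\<in>B - {x}. deg (B - {x}) v = M)"
        using bad' le_M[of "B - {x}"] by (intro less.hyps)
      have "nb B x \<noteq> {}" using dB by (rule contrapos_pn) simp
      then obtain y where "y \<in> nb B x" by blast
      then have y: "y \<in> B - {x}" "adj y x" using adj_irrefl[of x] adj_sym[of x y] by (auto simp: nb_def)
      have "deg (B - {x}) y < deg B y" using deg_remove1[of B x y] finAB x y by simp
      also have "deg B y \<le> M" using y BS by (intro le_M) auto
      finally have IH: "sparse M (B - {x})" using or y by auto
      have "(\<Sum>v\<in>S. deg S v) = r * card A + ((\<Sum>v\<in>B - {x}. deg (B - {x}) v) + 2)"
        using sumS sum_deg_remove[of B x] finAB x rM' by simp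
      moreover have "card S = card A + card (B - {x})" using cardS cardB by simp
      moreover have "int M * ((int M - 1) * int (card A) + int (\<Sum>v\<in>B - {x}. deg (B - {x}) v) + 2 + 2)
          \<le> (int M * int M - int M + 2) * (int (card A) + int (card (B - {x})))"
      proof (rule gallai_arith_pendant)
        show "int M \<le> int (card A)" using r(2) rM'(1) by simp
        show "int M * (int (\<Sum>v\<in>B - {x}. deg (B - {x}) v) + 2)
            \<le> (int M * int M - int M + 2) * int (card (B - {x}))"
          using IH by (simp only: sparse_def)
      qed
      moreover have "int r = int M - 1" using rM'(1) by simp
      ultimately show ?thesis by (simp add: sparse_def add_ac del: of_nat_sum)
    qed
    then show ?thesis ..
  qed
qed

text \<open>If \<open>S - {v}\<close> had a cut vertex, each of two disjoint leaf blocks of \<open>S - {v}\<close> would contain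
  at least \<open>r - 1\<close> neighbours of \<open>v\<close>, too many for \<open>r \<ge> 3\<close>.\<close>

lemma bad_nocut_complete:
  assumes "bad S L" "nocut S" and r: "\<And>v. v \<in> S \<Longrightarrow> deg S v = r" "3 \<le> r"
    and v: "v \<in> S" "w \<in> S" "v \<noteq> w"
  shows "adj v w"
proof -
  define T where "T = S - {v}"
  have finS: "finite S" and finT: "finite T" using assms(1) by (auto simp: bad_def T_def)
  have connT: "conn T" using assms(2) v by (auto simp: nocut_def T_def)
  have degT: "r = deg T u + (if adj v u then 1 else 0)" if "u \<in> T" for u
    using deg_remove1[OF finS v(1), of u] r(1)[of u] that adj_sym[of u v] adj_sym[of v u]
    by (auto simp: T_def split: if_splits)
  have "card (L v) = r" using bad_card_list[OF assms(1) v(1)] r(1)[OF v(1)] by simp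
  then obtain c where "c \<in> L v" using r(2) by fastforce
  then obtain L' where bad: "bad T L'"
    using bad_residual[OF assms(1) v(1)] connT by (auto simp: T_def)
  have leaf: "r - 1 \<le> deg P v" if P: "sep T P x" "nocut (insert x P)" for P x
  proof -
    have PT: "P \<subseteq> T" "x \<in> T" "x \<notin> P" "P \<noteq> {}" using P by (auto simp: sep_def)
    have finP: "finite P" using PT finT finite_subset by blast
    obtain d where d: "\<And>u. u \<in> insert x P \<Longrightarrow> deg (insert x P) u = d" "d + 1 \<le> card (insert x P)"
      using bad_nocut_deg bad_sep[OF bad P(1)] P(2) by blast
    have "\<exists>p\<in>P. adj v p"
    proof (rule ccontr)
      assume no: "\<not> ?thesis"
      have "conn (S - {x})" using assms(2) PT by (auto simp: nocut_def T_def)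
      moreover have "P \<subseteq> S - {x}" "P \<noteq> S - {x}" using PT v by (auto simp: T_def)
      ultimately have "\<not> no_edges P (S - {x} - P)" using PT(4) by (simp add: conn_def)
      then obtain u w where uw: "u \<in> P" "w \<in> S - {x} - P" "adj u w" by (auto simp: no_edges_def)
      then have "w \<noteq> v" using no adj_sym by blast
      then show False using uw P(1) by (auto simp: sep_def no_edges_def T_def)
    qed
    then obtain p where p: "p \<in> P" "adj v p" by blast
    have dP: "deg T u = d" if "u \<in> P" for u
      using deg_sep_inner[OF P(1) that] d(1)[of u] that by simp
    have dr: "r = d + 1" using degT[of p] dP[of p] p PT by auto
    have "adj v u" if "u \<in> P" for u
      using degT[of u] dP[OF that] dr that PT by (auto split: if_splits)
    then have "nb P v = P" by (auto simp: nb_def)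
    then show ?thesis using d(2) dr PT finP by simp
  qed
  have "nocut T"
  proof (rule ccontr)
    assume "\<not> nocut T"
    then obtain P x where P: "sep T P x" using not_nocut_sep by blast
    obtain P1 x1 where 1: "P1 \<subseteq> P" "sep T P1 x1" "nocut (insert x1 P1)"
      using sep_leaf[OF finT P] by blast
    obtain P2 x2 where 2: "P2 \<subseteq> T - {x} - P" "sep T P2 x2" "nocut (insert x2 P2)"
      using sep_leaf[OF finT sep_compl[OF P]] by blast
    have sub: "P1 \<union> P2 \<subseteq> S" using 1 2 by (auto simp: sep_def T_def)
    then have "finite P1" "finite P2" using finS finite_subset by auto
    then have "deg P1 v + deg P2 v = deg (P1 \<union> P2) v"
      using 1 2 by (intro deg_disjoint_Un[symmetric]) auto
    also have "\<dots> \<le> r" using deg_mono[OF finS sub, of v] r(1)[OF v(1)] by simp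
    finally show False using leaf[OF 1(2,3)] leaf[OF 2(2,3)] r(2) by linarith
  qed
  then obtain d where d: "\<And>u. u \<in> T \<Longrightarrow> deg T u = d" using bad_nocut_deg[OF bad] by blast
  have "deg S v > 0" using r(1)[OF v(1)] r(2) by simp
  then have "nb S v \<noteq> {}" by force
  then obtain y where "y \<in> nb S v" by blast
  then have "y \<in> T" "adj v y" using adj_irrefl[of v] by (auto simp: nb_def T_def)
  then have "r = d + 1" using degT[of y] d[of y] by simp
  moreover have "w \<in> T" using v by (simp add: T_def)
  ultimately show ?thesis using degT[of w] d[of w] by (auto split: if_splits)
qed

lemma bad_complete_triangle:
  assumes "bad S L" and complete: "\<And>u v. u \<in> S \<Longrightarrow> v \<in> S \<Longrightarrow> u \<noteq> v \<Longrightarrow> adj u v"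
    and S: "z \<in> S" "u \<in> S" "w \<in> S" "z \<noteq> u" "z \<noteq> w" "u \<noteq> w" and big: "2 \<le> deg S z"
  shows "s u w = s z u * s z w"
proof (rule ccontr)
  assume neg: "s u w \<noteq> s z u * s z w"
  have conn: "conn T" if "T \<subseteq> S" for T
    using complete that by (fastforce simp: conn_def no_edges_def)
  have "card (L z) \<ge> 2" using bad_card_list[OF assms(1) S(1)] big by simp
  then have "\<not> L z \<subseteq> {0}" using card_mono[of "{0}" "L z"] by fastforce
  then obtain a where a: "a \<in> L z" "a \<noteq> 0" by blast
  have u: "s z u * a \<in> L u" and w: "s z w * a \<in> L w"
    using bad_transport[OF assms(1) S(1) _ _ conn a(1)] complete S by auto
  define L' where "L' = residual {u} (\<lambda>_. s z u * a) L"
  have bad': "bad (S - {u}) L'"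
    unfolding L'_def by (rule bad_residual[OF assms(1) S(2) conn u]) auto
  have "s z w * a \<noteq> s w u * (s z u * a)"
    using neg a(2) s_cases[of u w] s_cases[of z u] s_cases[of z w] s_sym[of w u] by auto
  then have "s z w * a \<in> L' w" using w by (auto simp: L'_def residual_def nb_def)
  then have "s w z * (s z w * a) \<in> L' z"
    using bad_transport[OF bad', of w z] complete[of w z] S conn[of "S - {u} - {w}"] by blast
  then have "a \<in> L' z" by (simp add: s_sym[of w z])
  moreover have "adj z u" using complete S by simp
  ultimately show False by (auto simp: L'_def residual_def nb_def)
qed

lemma sum_deg_low:
  assumes "finite D" and conn: "\<And>T. T \<subseteq> D \<Longrightarrow> T \<noteq> {} \<Longrightarrow> conn T \<Longrightarrow> sparse M T"
  shows "int M * int (\<Sum>v\<in>D. deg D v) \<le> (int M * int M - int M + 2) * int (card D)"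
  using assms
proof (induction "card D" arbitrary: D rule: less_induct)
  case less
  show ?case
  proof (cases "D = {} \<or> conn D")
    case True
    then show ?thesis
    proof
      assume "conn D"
      show ?thesis
      proof (cases "D = {}")
        case False
        then have "sparse M D" using less.prems(2)[of D] \<open>conn D\<close> by simp
        then show ?thesis unfolding sparse_def by (simp add: algebra_simps)
      qed simp
    qed simp
  next
    case False
    then obtain P where P: "P \<subseteq> D" "P \<noteq> {}" "P \<noteq> D" "no_edges P (D - P)"
      by (auto simp: conn_def)
    have fin: "finite P" "finite (D - P)" using P less.prems(1) finite_subset by auto
    have degP: "deg P v = deg D v" if "v \<in> P" for v
    proof -
      have "nb P v = nb D v" using that P by (auto simp: nb_def no_edges_def)
      then show ?thesis by simp
    qed
    have degQ: "deg (D - P) v = deg D v" if "v \<in> D - P" for v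
    proof -
      have "nb (D - P) v = nb D v" using that no_edges_sym[OF P(4)] by (auto simp: nb_def no_edges_def)
      then show ?thesis by simp
    qed
    have "(\<Sum>v\<in>D. deg D v) = (\<Sum>v\<in>P. deg D v) + (\<Sum>v\<in>D - P. deg D v)"
      using less.prems(1) P(1) by (metis add.commute sum.subset_diff)
    also have "\<dots> = (\<Sum>v\<in>P. deg P v) + (\<Sum>v\<in>D - P. deg (D - P) v)"
      using degP degQ by simp
    finally have sum: "(\<Sum>v\<in>D. deg D v) = (\<Sum>v\<in>P. deg P v) + (\<Sum>v\<in>D - P. deg (D - P) v)" .
    have card: "card D = card P + card (D - P)"
      using less.prems(1) P(1) by (metis card_Diff_subset card_mono fin(1) le_add_diff_inverse)
    have "card P < card D" "card (D - P) < card D"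
      using P less.prems(1) by (auto intro!: psubset_card_mono)
    then have "int M * int (\<Sum>v\<in>P. deg P v) \<le> (int M * int M - int M + 2) * int (card P)"
      "int M * int (\<Sum>v\<in>D - P. deg (D - P) v) \<le> (int M * int M - int M + 2) * int (card (D - P))"
      using less.hyps[of P] less.hyps[of "D - P"] fin less.prems(2) P(1) by (meson Diff_subset subset_trans)+
    then show ?thesis unfolding sum card by (simp add: distrib_left)
  qed
qed

lemma critical_bad_low:
  assumes "finite V" "\<not> col V L" and proper: "\<And>S. S \<subset> V \<Longrightarrow> col S L"
    and lists: "\<And>v. v \<in> V \<Longrightarrow> finite (L v) \<and> card (L v) = M"
    and T: "T \<subseteq> V" "T \<noteq> {}" "conn T" "\<And>v. v \<in> T \<Longrightarrow> deg V v = M"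
  shows "\<exists>L'. bad T L'"
proof -
  have "col (V - T) L" using T by (intro proper) auto
  then obtain \<phi> where \<phi>: "proper_on (V - T) \<phi>" "\<forall>v\<in>V - T. \<phi> v \<in> L v" by (auto simp: col_def)
  let ?L = "residual (V - T) \<phi> L"
  have "V - (V - T) = T" using T(1) by auto
  then have "\<not> col T ?L" using col_residual[of "V - T" V \<phi> L] \<phi> assms(2) by auto
  moreover have "deg T v \<le> card (?L v)" if "v \<in> T" for v
    using card_residual[of "V - T" L v \<phi>] deg_split[OF assms(1) T(1), of v] T(4)[OF that]
      lists[of v] assms(1) T(1) that by auto
  moreover have "finite (?L v)" if "v \<in> T" for v
    using lists[of v] T(1) that by (auto simp: residual_def)
  ultimately have "bad T ?L"
    using T(3) finite_subset[OF T(1) assms(1)] by (simp add: bad_def)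
  then show ?thesis by blast
qed

lemma critical_degree_sum:
  assumes "finite V" "3 \<le> M" "\<not> col V L" and proper: "\<And>S. S \<subset> V \<Longrightarrow> col S L"
    and lists: "\<And>v. v \<in> V \<Longrightarrow> finite (L v) \<and> card (L v) = M"
  shows "(\<exists>L'. bad V L') \<and> nocut V \<and> (\<forall>v\<in>V. deg V v = M) \<or>
    (int M * int M + int M - 2) * (int M + 1) * int (card V)
      \<le> (int M * int M + 2 * int M - 2) * int (\<Sum>v\<in>V. deg V v)"
proof (cases "\<exists>T \<subseteq> V. T \<noteq> {} \<and> conn T \<and> (\<forall>v\<in>T. deg V v = M) \<and> \<not> sparse M T")
  case True
  then obtain T where T: "T \<subseteq> V" "T \<noteq> {}" "conn T" "\<And>v. v \<in> T \<Longrightarrow> deg V v = M" "\<not> sparse M T"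
    by blast
  obtain L' where bad: "bad T L'"
    using critical_bad_low[OF assms(1,3) proper lists T(1-4)] by blast
  have "deg T v \<le> M" if "v \<in> T" for v
    using deg_mono[OF assms(1) T(1), of v] T(4)[OF that] by simp
  then have reg: "nocut T" "\<And>v. v \<in> T \<Longrightarrow> deg T v = M"
    using bad_sparse[OF assms(2) bad] T(5) by blast+
  have "T = V"
  proof (rule ccontr)
    assume "T \<noteq> V"
    then have psub: "T \<subset> V" "V - T \<subset> V" using T(1,2) by auto
    obtain \<phi> where \<phi>: "proper_on T \<phi>" "\<forall>v\<in>T. \<phi> v \<in> L v"
      using proper[OF psub(1)] by (auto simp: col_def)
    have iso: "nb T v = {}" if "v \<in> V - T" for v
    proof (rule ccontr)
      assume "nb T v \<noteq> {}"
      then obtain u where u: "u \<in> T" "adj u v" using adj_sym unfolding nb_def by blast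
      have "deg V u = deg T u + deg (V - T) u" by (rule deg_split[OF assms(1) T(1)])
      then have "nb (V - T) u = {}" using T(4)[OF u(1)] reg(2)[OF u(1)] assms(1) by simp
      then show False using u that by (auto simp: nb_def)
    qed
    obtain \<psi> where \<psi>: "proper_on (V - T) \<psi>" "\<forall>v\<in>V - T. \<psi> v \<in> L v"
      using proper[OF psub(2)] by (auto simp: col_def)
    moreover have "\<forall>v\<in>V - T. \<psi> v \<in> residual T \<phi> L v"
      using \<psi>(2) iso by (simp add: residual_def)
    ultimately have "col (V - T) (residual T \<phi> L)" unfolding col_def by blast
    then show False using col_residual[OF T(1) \<phi>] assms(3) by blast
  qed
  then show ?thesis using bad reg by blast
next
  case False
  define D where "D = {v \<in> V. deg V v = M}"
  have D: "D \<subseteq> V" "finite D" "finite (V - D)" using assms(1) by (auto simp: D_def)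
  have low: "int M * int (\<Sum>v\<in>D. deg D v) \<le> (int M * int M - int M + 2) * int (card D)"
    using False by (intro sum_deg_low D(2)) (auto simp: D_def)
  have min_deg: "M \<le> deg V v" if v: "v \<in> V" for v
  proof (rule ccontr)
    assume less: "\<not> M \<le> deg V v"
    have "col (V - {v}) L" using v by (intro proper) auto
    then show False using col_extend[OF assms(1) v] lists[OF v] less assms(3) by simp
  qed
  have split: "(\<Sum>v\<in>V. deg V v) = M * card D + (\<Sum>v\<in>V - D. deg V v)"
  proof -
    have "(\<Sum>v\<in>V. deg V v) = (\<Sum>v\<in>D. deg V v) + (\<Sum>v\<in>V - D. deg V v)"
      using assms(1) D(1) by (metis add.commute sum.subset_diff)
    also have "(\<Sum>v\<in>D. deg V v) = M * card D" by (simp add: D_def)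
    finally show ?thesis .
  qed
  have rest: "(M + 1) * card (V - D) \<le> (\<Sum>v\<in>V - D. deg V v)"
  proof -
    have "M + 1 \<le> deg V v" if "v \<in> V - D" for v
      using min_deg[of v] that by (auto simp: D_def)
    then show ?thesis using sum_bounded_below[of "V - D" "M + 1" "deg V"] by (simp add: mult.commute)
  qed
  have high: "(int M + 1) * int (card V) - int (card D) \<le> int (\<Sum>v\<in>V. deg V v)"
  proof -
    have "card V = card D + card (V - D)"
      using D by (metis assms(1) card_Diff_subset card_mono le_add_diff_inverse)
    then have "(M + 1) * card V \<le> (\<Sum>v\<in>V. deg V v) + card D"
      using rest split by (simp add: algebra_simps)
    then have "int ((M + 1) * card V) \<le> int ((\<Sum>v\<in>V. deg V v) + card D)" by (simp only: of_nat_le_iff)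
    then show ?thesis by (simp add: algebra_simps del: of_nat_sum)
  qed
  have "M * card D \<le> (\<Sum>v\<in>D. deg D v) + (\<Sum>v\<in>V - D. deg V v)"
  proof -
    have "M * card D = (\<Sum>v\<in>D. deg V v)" by (simp add: D_def)
    also have "\<dots> = (\<Sum>v\<in>D. deg D v) + (\<Sum>v\<in>D. deg (V - D) v)"
      using deg_split[OF assms(1) D(1)] by (simp add: sum.distrib)
    also have "(\<Sum>v\<in>D. deg (V - D) v) = (\<Sum>v\<in>V - D. deg D v)"
    proof -
      have "(\<Sum>v\<in>D. deg (V - D) v) = (\<Sum>v\<in>D. \<Sum>u\<in>V - D. if adj v u then 1 else 0)"
        using D by (simp add: nb_def sum.If_cases Int_def)
      also have "\<dots> = (\<Sum>u\<in>V - D. \<Sum>v\<in>D. if adj v u then 1 else 0)" by (rule sum.swap)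
      also have "\<dots> = (\<Sum>u\<in>V - D. \<Sum>v\<in>D. if adj u v then 1 else 0)"
        using adj_sym by (intro sum.cong refl) auto
      also have "\<dots> = (\<Sum>v\<in>V - D. deg D v)"
        using D by (simp add: nb_def sum.If_cases Int_def)
      finally show ?thesis .
    qed
    also have "\<dots> \<le> (\<Sum>v\<in>V - D. deg V v)" by (intro sum_mono deg_mono assms(1) D(1))
    finally show ?thesis by simp
  qed
  then have "2 * M * card D \<le> (\<Sum>v\<in>V. deg V v) + (\<Sum>v\<in>D. deg D v)" using split by simp
  then have "int (2 * M * card D) \<le> int ((\<Sum>v\<in>V. deg V v) + (\<Sum>v\<in>D. deg D v))"
    by (simp only: of_nat_le_iff)
  then have cross: "2 * int M * int (card D) \<le> int (\<Sum>v\<in>V. deg V v) + int (\<Sum>v\<in>D. deg D v)"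
    by (simp del: of_nat_sum)
  have "int M * (2 * int M * int (card D)) \<le> int M * (int (\<Sum>v\<in>V. deg V v) + int (\<Sum>v\<in>D. deg D v))"
    using cross by (intro mult_left_mono) auto
  then have "(int M * int M + int M - 2) * int (card D) \<le> int M * int (\<Sum>v\<in>V. deg V v)"
    using low by (simp add: algebra_simps del: of_nat_sum)
  moreover have "0 \<le> int M * int M + int M - 2"
    using assms(2) mult_mono[of 3 "int M" 3 "int M"] by simp
  then have "(int M * int M + int M - 2) * ((int M + 1) * int (card V) - int (card D))
      \<le> (int M * int M + int M - 2) * int (\<Sum>v\<in>V. deg V v)"
    using high by (intro mult_left_mono)
  ultimately show ?thesis by (simp add: algebra_simps del: of_nat_sum)
qed

end

definition sg_adj :: "('v, 'e) sgraph \<Rightarrow> 'v \<Rightarrow> 'v \<Rightarrow> bool" where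
  "sg_adj G u w \<longleftrightarrow> (\<exists>e\<in>edges G. ends G e = {u, w})"

definition sg_sign :: "('v, 'e) sgraph \<Rightarrow> 'v \<Rightarrow> 'v \<Rightarrow> int" where
  "sg_sign G u w = (if sg_adj G u w then sign G (SOME e. e \<in> edges G \<and> ends G e = {u, w}) else 1)"

definition induced :: "('v, 'e) sgraph \<Rightarrow> 'v set \<Rightarrow> ('v, 'e) sgraph" where
  "induced G S = G\<lparr>verts := S, edges := {e \<in> edges G. ends G e \<subseteq> S}\<rparr>"

lemma simple_signed_sgraph:
  assumes "signed_graph G"
  shows "simple_signed (sg_adj G) (sg_sign G)"
proof
  interpret signed_graph G by fact
  fix u v :: 'a
  show "sg_adj G u v \<Longrightarrow> sg_adj G v u" by (auto simp: sg_adj_def insert_commute)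
  show "\<not> sg_adj G v v" using card_ends by (fastforce simp: sg_adj_def)
  show "sg_sign G u v = sg_sign G v u"
    by (simp add: sg_sign_def sg_adj_def insert_commute)
  show "sg_sign G u v = 1 \<or> sg_sign G u v = -1"
  proof (cases "sg_adj G u v")
    case True
    then have "\<exists>e. e \<in> edges G \<and> ends G e = {u, v}" by (auto simp: sg_adj_def)
    from someI_ex[OF this] show ?thesis using True sign_cases by (auto simp: sg_sign_def)
  qed (simp add: sg_sign_def)
qed

lemma card_edges_between_le:
  assumes "finite (verts G)" "v \<in> verts G" "w \<in> verts G" "v \<noteq> w"
  shows "card (edges_between G v w) \<le> max_mult G"
proof -
  let ?X = "{card (edges_between G v w) | v w. v \<in> verts G \<and> w \<in> verts G \<and> v \<noteq> w}"
  have "?X \<subseteq> (\<lambda>(v, w). card (edges_between G v w)) ` (verts G \<times> verts G)" by auto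
  then have "finite ?X" using assms(1) by (meson finite_SigmaI finite_imageI finite_subset)
  then show ?thesis unfolding max_mult_def using assms by (intro Max_ge) auto
qed

lemma edge_unique:
  assumes "signed_graph G" "max_mult G \<le> 1" "e \<in> edges G" "e' \<in> edges G" "ends G e = ends G e'"
  shows "e = e'"
proof -
  interpret signed_graph G by fact
  obtain v w where vw: "ends G e = {v, w}" "v \<noteq> w"
    using card_ends[OF assms(3)] by (auto simp: card_2_iff)
  then have "card (edges_between G v w) \<le> 1"
    using card_edges_between_le[of G v w] finite_verts ends_subset[OF assms(3)] assms(2) by auto
  moreover have "finite (edges_between G v w)" using finite_edges by (simp add: edges_between_def)
  moreover have "e \<in> edges_between G v w" "e' \<in> edges_between G v w"
    using assms vw by (auto simp: edges_between_def)
  ultimately show ?thesis using card_le_Suc0_iff_eq[of "edges_between G v w"] by auto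
qed

lemma sg_sign_edge:
  assumes "signed_graph G" "max_mult G \<le> 1" "e \<in> edges G" "ends G e = {u, w}"
  shows "sg_sign G u w = sign G e"
proof -
  have ex: "\<exists>e. e \<in> edges G \<and> ends G e = {u, w}" using assms by blast
  have "(SOME e. e \<in> edges G \<and> ends G e = {u, w}) = e"
    using someI_ex[OF ex] edge_unique[OF assms(1,2)] assms(3,4) by auto
  then show ?thesis using assms by (auto simp: sg_sign_def sg_adj_def)
qed

lemma col_iff_list_colorable_induced:
  assumes "signed_graph G" "max_mult G \<le> 1" "S \<subseteq> verts G"
  shows "simple_signed.col (sg_adj G) (sg_sign G) S L \<longleftrightarrow> list_colorable (induced G S) L"
proof -
  interpret simple_signed "sg_adj G" "sg_sign G" by (rule simple_signed_sgraph) fact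
  have "proper_on S \<phi> \<longleftrightarrow> coloring (induced G S) \<phi>" for \<phi>
  proof
    assume *: "proper_on S \<phi>"
    show "coloring (induced G S) \<phi>"
      unfolding coloring_def
    proof (intro ballI allI impI)
      fix e v w assume "e \<in> edges (induced G S)" "ends (induced G S) e = {v, w}"
      then have e: "e \<in> edges G" "ends G e = {v, w}" "v \<in> S" "w \<in> S" by (auto simp: induced_def)
      then have "sg_adj G v w" by (auto simp: sg_adj_def)
      then have "\<phi> v \<noteq> sg_sign G v w * \<phi> w" using * e by (simp add: proper_on_def)
      then show "\<phi> v \<noteq> sign (induced G S) e * \<phi> w"
        using sg_sign_edge[OF assms(1,2) e(1,2)] by (simp add: induced_def)
    qed
  next
    assume *: "coloring (induced G S) \<phi>"
    show "proper_on S \<phi>"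
      unfolding proper_on_def
    proof (intro ballI impI)
      fix u v assume uv: "u \<in> S" "v \<in> S" "sg_adj G u v"
      then obtain e where e: "e \<in> edges G" "ends G e = {u, v}" by (auto simp: sg_adj_def)
      then have "\<phi> u \<noteq> sign G e * \<phi> v" using * uv by (auto simp: coloring_def induced_def)
      then show "\<phi> u \<noteq> sg_sign G u v * \<phi> v" using sg_sign_edge[OF assms(1,2) e] by simp
    qed
  qed
  then show ?thesis by (auto simp: col_def list_colorable_def list_coloring_def induced_def)
qed

lemma induced_verts: "signed_graph G \<Longrightarrow> induced G (verts G) = G"
  using signed_graph.ends_subset[of G] by (auto simp: induced_def intro!: sgraph.equality)

lemma proper_signed_subgraph_induced:
  assumes "signed_graph G" "S \<subset> verts G"
  shows "proper_signed_subgraph (induced G S) G"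
proof -
  interpret signed_graph G by fact
  have "signed_graph (induced G S)"
    using assms finite_verts finite_edges card_ends sign_cases
    by unfold_locales (auto simp: induced_def intro: finite_subset)
  then show ?thesis
    using assms by (auto simp: proper_signed_subgraph_def signed_subgraph_def induced_def)
qed

lemma sum_deg_le_edges:
  assumes "signed_graph G"
  shows "(\<Sum>v\<in>verts G. card (simple_signed.nb (sg_adj G) (verts G) v)) \<le> 2 * card (edges G)"
proof -
  interpret signed_graph G by fact
  interpret S: simple_signed "sg_adj G" "sg_sign G" by (rule simple_signed_sgraph) fact
  have "card (S.nb (verts G) v) \<le> card {e \<in> edges G. v \<in> ends G e}" for v
  proof (rule surj_card_le)
    let ?f = "\<lambda>e. the_elem (ends G e - {v})"
    show "S.nb (verts G) v \<subseteq> ?f ` {e \<in> edges G. v \<in> ends G e}"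
    proof
      fix w assume "w \<in> S.nb (verts G) v"
      then have "sg_adj G v w" by (simp add: S.nb_def)
      then obtain e where e: "e \<in> edges G" "ends G e = {v, w}" by (auto simp: sg_adj_def)
      moreover have "v \<noteq> w" using card_ends[OF e(1)] e(2) by auto
      ultimately have "ends G e - {v} = {w}" by auto
      then show "w \<in> ?f ` {e \<in> edges G. v \<in> ends G e}"
        using e by (intro image_eqI[of _ _ e]) auto
    qed
  qed (use finite_edges in auto)
  then have "(\<Sum>v\<in>verts G. card (S.nb (verts G) v)) \<le> (\<Sum>v\<in>verts G. card {e \<in> edges G. v \<in> ends G e})"
    by (rule sum_mono)
  also have "\<dots> = (\<Sum>e\<in>edges G. card {v \<in> verts G. v \<in> ends G e})"
    using sum_multicount_gen[OF finite_verts finite_edges, of "\<lambda>v e. v \<in> ends G e"] by auto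
  also have "\<dots> = (\<Sum>e\<in>edges G. 2)"
  proof (rule sum.cong)
    fix e assume e: "e \<in> edges G"
    then have "{v \<in> verts G. v \<in> ends G e} = ends G e" using ends_subset by blast
    then show "card {v \<in> verts G. v \<in> ends G e} = 2" using card_ends[OF e] by simp
  qed simp
  finally show ?thesis by simp
qed

lemma balanced_if_switching_equivalent:
  assumes \<tau>: "\<And>v. \<tau> v = 1 \<or> \<tau> v = (-1 :: int)"
    and sign: "\<And>e v w. e \<in> edges G \<Longrightarrow> ends G e = {v, w} \<Longrightarrow> sign G e = \<tau> v * \<tau> w"
  shows "balanced G"
  unfolding balanced_def
proof (intro allI impI)
  fix vs es assume c: "cycle G vs es"
  then obtain m where m: "length vs = Suc m" "length es = Suc m"
    unfolding cycle_def by (metis Suc_le_D numeral_2_eq_2)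
  have "prod_list (map (sign G) es) = (\<Prod>i<Suc m. sign G (es ! i))"
    using m by (simp add: prod.list_conv_set_nth atLeast0LessThan del: prod.lessThan_Suc)
  also have "\<dots> = (\<Prod>i<Suc m. \<tau> (vs ! i) * \<tau> (vs ! (Suc i mod Suc m)))"
    using c m by (intro prod.cong refl sign) (auto simp: cycle_def subset_iff)
  also have "\<dots> = (\<Prod>i<Suc m. \<tau> (vs ! i)) * (\<Prod>i<Suc m. \<tau> (vs ! (Suc i mod Suc m)))"
    by (rule prod.distrib)
  also have "(\<Prod>i<Suc m. \<tau> (vs ! (Suc i mod Suc m))) = (\<Prod>i<m. \<tau> (vs ! Suc i)) * \<tau> (vs ! 0)"
    by simp
  also have "\<dots> = (\<Prod>i<Suc m. \<tau> (vs ! i))"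
    by (simp only: prod.lessThan_Suc_shift mult.commute)
  also have "(\<Prod>i<Suc m. \<tau> (vs ! i)) * (\<Prod>i<Suc m. \<tau> (vs ! i)) = (\<Prod>i<Suc m. \<tau> (vs ! i) * \<tau> (vs ! i))"
    by (rule prod.distrib[symmetric])
  also have "\<dots> = (\<Prod>i<Suc m. 1)"
  proof (rule prod.cong)
    show "\<tau> (vs ! i) * \<tau> (vs ! i) = 1" for i using \<tau>[of "vs ! i"] by auto
  qed simp
  finally show "prod_list (map (sign G) es) = 1" by simp
qed

lemma balanced_complete_if_bad:
  assumes "signed_graph G" "max_mult G \<le> 1" "3 \<le> M"
    and bad: "simple_signed.bad (sg_adj G) (sg_sign G) (verts G) L"
    and nocut: "simple_signed.nocut (sg_adj G) (verts G)"
    and reg: "\<And>v. v \<in> verts G \<Longrightarrow> card (simple_signed.nb (sg_adj G) (verts G) v) = M"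
  shows "balanced_complete (M + 1) G"
proof -
  interpret signed_graph G by fact
  interpret S: simple_signed "sg_adj G" "sg_sign G" by (rule simple_signed_sgraph) fact
  have complete: "sg_adj G u v" if "u \<in> verts G" "v \<in> verts G" "u \<noteq> v" for u v
    using S.bad_nocut_complete[OF bad nocut reg assms(3) that] .
  obtain z where z: "z \<in> verts G" using S.bad_nonempty[OF bad] by blast
  have "S.nb (verts G) z = verts G - {z}"
    using complete[OF z] S.adj_irrefl by (auto simp: S.nb_def)
  then have card: "card (verts G) = M + 1"
    using reg[OF z] card_Suc_Diff1[OF finite_verts z] by simp
  define \<tau> where "\<tau> v = (if v = z then 1 else sg_sign G z v)" for v
  have "balanced G"
  proof (rule balanced_if_switching_equivalent)
    show "\<tau> v = 1 \<or> \<tau> v = -1" for v using S.s_cases[of z v] by (simp add: \<tau>_def)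
    fix e v w assume e: "e \<in> edges G" "ends G e = {v, w}"
    have vw: "v \<in> verts G" "w \<in> verts G" "v \<noteq> w"
      using ends_subset[OF e(1)] card_ends[OF e(1)] e(2) by auto
    have "sg_sign G v w = sg_sign G z v * sg_sign G z w" if "z \<noteq> v" "z \<noteq> w"
      using S.bad_complete_triangle[OF bad complete z vw(1,2) that vw(3)] reg[OF z] assms(3) by simp
    then have "sg_sign G v w = \<tau> v * \<tau> w"
      using vw(3) S.s_sym[of v w] by (auto simp: \<tau>_def)
    then show "sign G e = \<tau> v * \<tau> w" using sg_sign_edge[OF assms(1,2) e] by simp
  qed
  moreover have "card (edges_between G v w) = 1" if vw: "v \<in> verts G" "w \<in> verts G" "v \<noteq> w" for v w
  proof -
    obtain e where "e \<in> edges_between G v w"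
      using complete[OF vw] by (auto simp: sg_adj_def edges_between_def)
    moreover have "finite (edges_between G v w)" using finite_edges by (simp add: edges_between_def)
    ultimately have "card (edges_between G v w) > 0" by (auto simp: card_gt_0_iff)
    then show ?thesis using card_edges_between_le[OF finite_verts vw] assms(2) by linarith
  qed
  ultimately show ?thesis using assms(1) card by (simp add: balanced_complete_def)
qed

theorem theorem16:
  fixes G :: "('v, 'e) sgraph" and k :: nat
  assumes "k \<ge> 4"
    and "signed_graph G"
    and "k_list_critical k G"
    and "max_mult G \<le> 1"
    and "\<not> balanced_complete k G"
  shows "2 * real (card (edges G)) \<ge>
    (real k - 1 + (real k - 3) / ((real k)\<^sup>2 - 3)) * real (card (verts G))"
proof -
  interpret signed_graph G by fact
  interpret S: simple_signed "sg_adj G" "sg_sign G" by (rule simple_signed_sgraph) fact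
  obtain L where lists: "\<And>v. v \<in> verts G \<Longrightarrow> finite (L v) \<and> card (L v) = k - 1"
    and crit: "list_critical G L"
    using assms(3) by (auto simp: k_list_critical_def)
  define M where "M = k - 1"
  have M: "3 \<le> M" "k = M + 1" using assms(1) by (auto simp: M_def)
  have "\<not> S.col (verts G) L"
    using crit col_iff_list_colorable_induced[OF assms(2,4)] induced_verts[OF assms(2)]
    by (simp add: list_critical_def)
  moreover have "S.col T L" if "T \<subset> verts G" for T
    using crit proper_signed_subgraph_induced[OF assms(2) that]
      col_iff_list_colorable_induced[OF assms(2,4), of T] that
    by (auto simp: list_critical_def)
  moreover have "\<not> ((\<exists>L'. S.bad (verts G) L') \<and> S.nocut (verts G) \<and>
      (\<forall>v\<in>verts G. S.deg (verts G) v = M))"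
    using balanced_complete_if_bad[OF assms(2,4) M(1)] assms(5) M(2) by blast
  ultimately have "(int M * int M + int M - 2) * (int M + 1) * int (card (verts G))
      \<le> (int M * int M + 2 * int M - 2) * int (\<Sum>v\<in>verts G. S.deg (verts G) v)"
    using S.critical_degree_sum[OF finite_verts M(1), of L] lists unfolding M_def by blast
  also have "\<dots> \<le> (int M * int M + 2 * int M - 2) * int (2 * card (edges G))"
    using sum_deg_le_edges[OF assms(2)] M(1) mult_mono[of 3 "int M" 3 "int M"]
    by (intro mult_left_mono) (simp_all only: of_nat_le_iff, simp)
  finally have "real_of_int ((int M * int M + int M - 2) * (int M + 1) * int (card (verts G)))
      \<le> real_of_int ((int M * int M + 2 * int M - 2) * int (2 * card (edges G)))"
    by (simp only: of_int_le_iff)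
  then have main: "(real k - 2) * (real k + 1) * real k * real (card (verts G))
      \<le> ((real k)\<^sup>2 - 3) * (2 * real (card (edges G)))"
    unfolding M(2) by (simp add: power2_eq_square algebra_simps)
  have "4 * 4 \<le> real k * real k" using assms(1) by (intro mult_mono) auto
  then have pos: "0 < (real k)\<^sup>2 - 3" by (simp add: power2_eq_square)
  have "(real k - 1 + (real k - 3) / ((real k)\<^sup>2 - 3))
      = (real k - 2) * (real k + 1) * real k / ((real k)\<^sup>2 - 3)"
    using pos by (simp add: field_simps power2_eq_square)
  then show ?thesis
    using main pos by (simp add: pos_divide_le_eq mult.commute)
qed

end
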